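(* Let $\mathbb{F}$ be a field with $\operatorname{char}(\mathbb{F})\neq 2$, let $L$ be a (right) Leibniz algebra over $\mathbb{F}$ and let $d\in\operatorname{Der}(L)$ be a derivation of $L$. The following statements are equivalent: (i) $d\in\operatorname{Der}_{\mathrm{Lie}}(L)$; (ii) $d\in\operatorname{ADer}(L)$; (iii) $(d,d)\in\operatorname{Bider}(L)$.
   Context: A (right) Leibniz algebra over $\mathbb{F}$ is a vector space $L$ over $\mathbb{F}$ with a bilinear map $[-,-]\colon L\times L\to L$ satisfying $[[x,y],z]=[[x,z],y]+[x,[y,z]]$ for all $x,y,z\in L$. A derivation of $L$ is a linear map $d\colon L\to L$ with $d([x,y])=[d(x),y]+[x,d(y)]$ for all $x,y\in L$; $\operatorname{Der}(L)$ is the set of all derivations. An anti-derivation of $L$ is a linear map $D\colon L\to L$ with $D([x,y])=[D(x),y]-[D(y),x]$ for all $x,y\in L$; $\operatorname{ADer}(L)$ is the set of all anti-derivations. A biderivation of $L$ is a pair $(d,D)\in\operatorname{Der}(L)\times\operatorname{ADer}(L)$ such that $[x,d(y)]=[x,D(y)]$ for all $x,y\in L$; $\operatorname{Bider}(L)$ is the set of all biderivations. The Lie-center of $L$ is $Z_{\mathrm{Lie}}(L)=\{x\in L\mid [x,y]+[y,x]=0\ \text{for all } y\in L\}$. The set of Lie-derivations of $L$ is $\operatorname{Der}_{\mathrm{Lie}}(L)=\{d\in\operatorname{Der}(L)\mid \operatorname{Im}(d)\subseteq Z_{\mathrm{Lie}}(L)\}$. *)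

theory Defs
  imports HOL.Vector_Spaces
begin

locale leibniz_algebra = vector_space scale
  for scale :: "'f::field \<Rightarrow> 'v::ab_group_add \<Rightarrow> 'v" +
  fixes bracket :: "'v \<Rightarrow> 'v \<Rightarrow> 'v"
  assumes linear_bracket_left: "Vector_Spaces.linear scale scale (\<lambda>x. bracket x y)"
    and linear_bracket_right: "Vector_Spaces.linear scale scale (\<lambda>y. bracket x y)"
    and leibniz_identity:
      "bracket (bracket x y) z = bracket (bracket x z) y + bracket x (bracket y z)"
begin

definition Der :: "('v \<Rightarrow> 'v) set" where
  "Der = {d. Vector_Spaces.linear scale scale d \<and>
             (\<forall>x y. d (bracket x y) = bracket (d x) y + bracket x (d y))}"

definition ADer :: "('v \<Rightarrow> 'v) set" where
  "ADer = {D. Vector_Spaces.linear scale scale D \<and>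
              (\<forall>x y. D (bracket x y) = bracket (D x) y - bracket (D y) x)}"

definition Bider :: "(('v \<Rightarrow> 'v) \<times> ('v \<Rightarrow> 'v)) set" where
  "Bider = {(d, D) \<in> Der \<times> ADer. \<forall>x y. bracket x (d y) = bracket x (D y)}"

definition Lie_center :: "'v set" where
  "Lie_center = {x. \<forall>y. bracket x y + bracket y x = 0}"

definition Der_Lie :: "('v \<Rightarrow> 'v) set" where
  "Der_Lie = {d \<in> Der. range d \<subseteq> Lie_center}"

end

end

theory Submission
  imports Defs
begin

text \<open>
  The three conditions are the same identity in three guises. For a derivation, $d[x,y]$ is
  $[d(x),y]+[x,d(y)]$, while the anti-derivation law asks that it be $[d(x),y]-[d(y),x]$.
  Cancelling $[d(x),y]$ leaves $[d(y),x]+[x,d(y)]=0$ for all $x,y$, which says exactly that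
  every $d(y)$ lies in the Lie-center; this gives (i) iff (ii). For (iii), the compatibility
  condition of a biderivation compares $d$ with itself and holds trivially for the pair $(d,d)$,
  so only membership in the two spaces remains.
\<close>

context leibniz_algebra
begin

lemma Der_imp_Der_Lie_iff_ADer:
  assumes "d \<in> Der"
  shows "d \<in> Der_Lie \<longleftrightarrow> d \<in> ADer"
proof -
  have lin: "Vector_Spaces.linear scale scale d"
    and der: "d (bracket x y) = bracket (d x) y + bracket x (d y)" for x y
    using assms by (auto simp: Der_def)
  have "bracket (d y) x + bracket x (d y) = 0
      \<longleftrightarrow> d (bracket x y) = bracket (d x) y - bracket (d y) x" for x y
    by (auto simp: der eq_neg_iff_add_eq_0 add.commute algebra_simps)
  then have "range d \<subseteq> Lie_center
      \<longleftrightarrow> (\<forall>x y. d (bracket x y) = bracket (d x) y - bracket (d y) x)"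
    unfolding Lie_center_def by blast
  then show ?thesis
    using assms lin by (simp add: Der_Lie_def ADer_def)
qed

lemma diagonal_Bider_iff: "(d, d) \<in> Bider \<longleftrightarrow> d \<in> Der \<and> d \<in> ADer"
  by (simp add: Bider_def)

end

theorem theorem3p7:
  fixes scale :: "'f::field \<Rightarrow> 'v::ab_group_add \<Rightarrow> 'v"
    and bracket :: "'v \<Rightarrow> 'v \<Rightarrow> 'v"
    and d :: "'v \<Rightarrow> 'v"
  assumes "CHAR('f) \<noteq> 2"
    and "leibniz_algebra scale bracket"
    and "d \<in> leibniz_algebra.Der scale bracket"
  shows "(d \<in> leibniz_algebra.Der_Lie scale bracket
            \<longleftrightarrow> d \<in> leibniz_algebra.ADer scale bracket)
       \<and> (d \<in> leibniz_algebra.ADer scale bracket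
            \<longleftrightarrow> (d, d) \<in> leibniz_algebra.Bider scale bracket)"
proof -
  interpret leibniz_algebra scale bracket by fact
  show ?thesis
    using assms(3) Der_imp_Der_Lie_iff_ADer diagonal_Bider_iff by blast
qed

end
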